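(* Let $m, n$ be positive even integers and let $k$ be an integer with $k \geq (-1)^{n-1} f_{n-2}(m) + 1$. Put $$s = (-1)^n f_n(m) f_{n-1}(m) + k f_{n+1}(m), \quad t = (-1)^{n-1} f_{n-1}(m)^2 - k f_n(m), \quad \beta(n,m,k) = \sqrt{s^2 - 4t}.$$ Let $\mathbf v(m) = (\frac{m}{2}, 2m, \frac{m}{2}, 2m, \ldots, \frac{m}{2}, 2m)$ be the finite sequence of length $n$ alternating $\frac m2$ and $2m$ (starting with $\frac m2$), let $\mathbf v(m)^R$ be $\mathbf v(m)$ reversed, and let $\mathbf u(m) = (1, 1, \frac{m-2}{2}, 1, 1, \frac{m-2}{2}, \ldots, 1, 1, \frac{m-2}{2})$ be the sequence of length $3n$ obtained by repeating the block $(1,1,\frac{m-2}{2})$ $n$ times. Then: (1) if $k$ is even, $\beta(n,m,k) = [s; \overline{\mathbf v(m), \frac{s}{2}, \mathbf v(m)^R, 2s}]$; (2) if $k$ is odd and $m > 2$, $\beta(n,m,k) = [s; \overline{\mathbf v(m), \frac{s-1}{2}, \mathbf u(m), 1, 1, \frac{s-1}{2}, \mathbf v(m)^R, 2s}]$; (3) if $k$ is odd and $m = 2$, $\beta(n,2,k) = [s; \overline{\mathbf v(2), \frac{s-1}{2}, 1, \mathbf 2, 1, \frac{s-1}{2}, \mathbf v(2)^R, 2s}]$, where $\mathbf 2$ denotes the sequence of length $n$ all of whose terms equal $2$.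
   Context: The Fibonacci polynomials $f_h(m)$, for a fixed integer $m$, are defined by $f_0(m) = 0$, $f_1(m) = 1$, $f_h(m) = m f_{h-1}(m) + f_{h-2}(m)$ for $h \geq 2$, and $f_{-h}(m) = (-1)^{h-1} f_h(m)$ for $h \geq 1$. $[b_0; b_1, b_2, \ldots]$ denotes a simple continued fraction, and an overline denotes the periodically repeated block (sequences inside it are concatenated). *)

theory Defs
  imports "HOL-Analysis.Analysis"
begin

fun fib_poly_nat :: "nat \<Rightarrow> int \<Rightarrow> int" where
  "fib_poly_nat 0 m = 0"
| "fib_poly_nat (Suc 0) m = 1"
| "fib_poly_nat (Suc (Suc h)) m = m * fib_poly_nat (Suc h) m + fib_poly_nat h m"

(* Extension to negative indices by f_{-h}(m) = (-1)^(h-1) f_h(m) for h >= 1. *)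
definition fib_poly :: "int \<Rightarrow> int \<Rightarrow> int" where
  "fib_poly h m =
     (if h \<ge> 0 then fib_poly_nat (nat h) m
      else (-1) ^ (nat (-h) - 1) * fib_poly_nat (nat (-h)) m)"

(* cf_convergent b N = [b 0; b 1, ..., b N] *)
primrec cf_convergent :: "(nat \<Rightarrow> int) \<Rightarrow> nat \<Rightarrow> real" where
  "cf_convergent b 0 = real_of_int (b 0)"
| "cf_convergent b (Suc N) = real_of_int (b 0) + 1 / cf_convergent (\<lambda>i. b (Suc i)) N"

(* x = [b 0; b 1, b 2, ...] as an infinite simple continued fraction: all partial quotients
   after the first are positive integers (so no convergent involves a division by 0),
   and the convergents tend to x. *)
definition has_simple_cf :: "real \<Rightarrow> (nat \<Rightarrow> int) \<Rightarrow> bool" where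
  "has_simple_cf x b \<longleftrightarrow> (\<forall>i\<ge>1. b i \<ge> 1) \<and> cf_convergent b \<longlonglongrightarrow> x"

(* The sequence b0; bs, bs, bs, ... (bs is meant to be nonempty) *)
definition periodic_seq :: "int \<Rightarrow> int list \<Rightarrow> nat \<Rightarrow> int" where
  "periodic_seq b0 bs i = (if i = 0 then b0 else bs ! ((i - 1) mod length bs))"

(* m div 2 and (m - 2) div 2 are exact for even m, the only case of interest. *)
definition v_seq :: "nat \<Rightarrow> int \<Rightarrow> int list" where
  "v_seq n m = map (\<lambda>i. if even i then m div 2 else 2 * m) [0..<n]"

definition u_seq :: "nat \<Rightarrow> int \<Rightarrow> int list" where
  "u_seq n m = concat (replicate n [1, 1, (m - 2) div 2])"

end

theory Submission
  imports Defs
begin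

text \<open>
  Write \<open>a\<close>, \<open>b\<close>, \<open>d\<close> for \<open>f\<^sub>n\<^sub>+\<^sub>1\<close>, \<open>f\<^sub>n\<close>, \<open>f\<^sub>n\<^sub>-\<^sub>1\<close>.  Let \<open>P\<close> be the period without its last term \<open>2s\<close>.
  A real number \<open>x > s\<close> has the expansion \<open>[s; P, 2s, P, 2s, \<dots>]\<close> as soon as
  \<open>1 / (x - s) = [P; x + s]\<close>, because the complete quotients can then be read off.
  The Moebius transformations of the blocks are computed by powers of two-by-two matrices: \<open>v\<close> gives
  \<open>(a, b/2; 2b, d)\<close>, the reversal of \<open>v\<close> its transpose, and in both odd cases the block strictly
  between the two middle terms \<open>(s - 1)/2\<close> gives \<open>(2a, a + b; a + b, (a + d)/2 + b)\<close>.
  The required equation becomes a polynomial identity modulo \<open>x\<^sup>2 = s\<^sup>2 - 4t\<close> and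
  \<open>- at = bs + d\<close>; the latter follows from Cassini's identity \<open>ad = b\<^sup>2 + 1\<close>.
\<close>

section \<open>Complete quotients and periodic expansions\<close>

lemma cf_convergent_ge_1:
  assumes "\<And>i. b i \<ge> 1"
  shows "cf_convergent b N \<ge> 1"
  using assms
proof (induction N arbitrary: b)
  case 0
  then show ?case by simp
next
  case (Suc N)
  have "cf_convergent (\<lambda>i. b (Suc i)) N \<ge> 1"
    using Suc.prems by (intro Suc.IH)
  moreover have "real_of_int (b 0) \<ge> 1"
    using Suc.prems[of 0] by simp
  ultimately show ?case
    by (simp add: add_increasing2)
qed

text \<open>A single step \<open>z -> q + 1/z\<close> is only 1-Lipschitz on \<open>z >= 1\<close>.
  Two steps have slope \<open>1 / (p x + 1)^2\<close>, at most 1/4.\<close>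

lemma abs_diff_two_cf_steps:
  fixes p q x y :: real
  assumes "p \<ge> 1" "x \<ge> 1" "y \<ge> 1"
  shows "\<bar>(q + 1 / (p + 1 / x)) - (q + 1 / (p + 1 / y))\<bar> \<le> \<bar>x - y\<bar> / 4"
proof -
  have px: "p * x + 1 \<ge> 2" and py: "p * y + 1 \<ge> 2"
    using assms mult_mono[of 1 p 1 x] mult_mono[of 1 p 1 y] by simp_all
  have "p + 1 / x = (p * x + 1) / x" "p + 1 / y = (p * y + 1) / y"
    using assms by (simp_all add: add_divide_distrib)
  then have "(q + 1 / (p + 1 / x)) - (q + 1 / (p + 1 / y)) = x / (p * x + 1) - y / (p * y + 1)"
    by simp
  also have "\<dots> = (x - y) / ((p * x + 1) * (p * y + 1))"
    using px py by (simp add: divide_simps) (simp add: algebra_simps)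
  finally have eq: "(q + 1 / (p + 1 / x)) - (q + 1 / (p + 1 / y))
      = (x - y) / ((p * x + 1) * (p * y + 1))" .
  have "4 \<le> (p * x + 1) * (p * y + 1)"
    using mult_mono[OF px py] px by simp
  then show ?thesis
    unfolding eq abs_divide by (intro frac_le) auto
qed

text \<open>The \<open>X i\<close> are the complete quotients. The induction descends two levels at
  a time, where the contraction gains 4 = 2^2. The factor 2 makes the bound 1 at
  \<open>N = 1\<close>, which suits two reciprocals lying in [0, 1].\<close>

lemma cf_convergent_error:
  fixes b :: "nat \<Rightarrow> int" and X :: "nat \<Rightarrow> real"
  assumes "\<And>i. i \<ge> 1 \<Longrightarrow> b i \<ge> 1" "\<And>i. i \<ge> 1 \<Longrightarrow> X i \<ge> 1"
    and "\<And>i. X i = b i + 1 / X (Suc i)"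
  shows "\<bar>X 0 - cf_convergent b N\<bar> \<le> 2 * (1 / 2) ^ N"
  using assms
proof (induction N arbitrary: b X rule: induct_nat_012)
  case 0
  have "X 0 = b 0 + 1 / X 1" "X 1 \<ge> 1"
    using "0.prems"(3)[of 0] "0.prems"(2)[of 1] by simp_all
  moreover from this have "0 \<le> 1 / X 1" "1 / X 1 \<le> 1"
    by simp_all
  ultimately show ?case
    by (simp only: cf_convergent.simps power_0)
next
  case 1
  have "X 0 = b 0 + 1 / X 1" "X 1 \<ge> 1" "real_of_int (b 1) \<ge> 1"
    using "1.prems"(3)[of 0] "1.prems"(2)[of 1] "1.prems"(1)[of 1] by simp_all
  moreover from this have "0 \<le> 1 / X 1" "1 / X 1 \<le> 1"
    "0 \<le> 1 / real_of_int (b 1)" "1 / real_of_int (b 1) \<le> 1"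
    by simp_all
  then have "\<bar>1 / X 1 - 1 / real_of_int (b 1)\<bar> \<le> 1"
    by linarith
  ultimately show ?case by simp
next
  case (ge2 N)
  let ?b = "\<lambda>i. b (Suc (Suc i))" and ?X = "\<lambda>i. X (Suc (Suc i))"
  have IH: "\<bar>?X 0 - cf_convergent ?b N\<bar> \<le> 2 * (1 / 2) ^ N"
    by (intro ge2.IH(1) ge2.prems) auto
  have X: "X 0 = b 0 + 1 / (b 1 + 1 / X 2)"
    using ge2.prems(3)[of 0] ge2.prems(3)[of 1] by (simp add: numeral_2_eq_2)
  have "\<bar>X 0 - cf_convergent b (Suc (Suc N))\<bar> \<le> \<bar>X 2 - cf_convergent ?b N\<bar> / 4"
    using abs_diff_two_cf_steps[of "b 1" "X 2" "cf_convergent ?b N" "b 0"] X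
      ge2.prems(1)[of 1] ge2.prems(2)[of 2] cf_convergent_ge_1[of ?b N, OF ge2.prems(1)]
    by simp
  also have "\<dots> \<le> 2 * (1 / 2) ^ Suc (Suc N)"
    using IH by (simp add: numeral_2_eq_2)
  finally show ?case .
qed

lemma has_simple_cf_complete_quotients:
  fixes b :: "nat \<Rightarrow> int" and X :: "nat \<Rightarrow> real"
  assumes "\<And>i. i \<ge> 1 \<Longrightarrow> b i \<ge> 1" "\<And>i. i \<ge> 1 \<Longrightarrow> X i \<ge> 1"
    and "\<And>i. X i = b i + 1 / X (Suc i)"
  shows "has_simple_cf (X 0) b"
proof -
  have "(\<lambda>N. 2 * (1 / 2 :: real) ^ N) \<longlonglongrightarrow> 2 * 0"
    by (intro tendsto_mult_left LIMSEQ_power_zero) simp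
  then have "(\<lambda>N. 2 * (1 / 2 :: real) ^ N) \<longlonglongrightarrow> 0"
    by simp
  moreover have "norm (cf_convergent b N - X 0) \<le> 2 * (1 / 2) ^ N" for N
    using cf_convergent_error[of b X N, OF assms] by (simp add: abs_minus_commute)
  ultimately have "(\<lambda>N. cf_convergent b N - X 0) \<longlonglongrightarrow> 0"
    by (rule Lim_null_comparison[rotated, OF _ always_eventually, OF _ allI])
  then show ?thesis
    using assms(1) by (simp add: has_simple_cf_def LIM_zero_iff)
qed

section \<open>Finite blocks ended by a real complete quotient, and periodicity\<close>

primrec cf_eval :: "int list \<Rightarrow> real \<Rightarrow> real" where
  "cf_eval [] z = z"
| "cf_eval (a # as) z = a + 1 / cf_eval as z"

text \<open>\<open>cf_eval\<close> in homogeneous coordinates.\<close>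

primrec cf_act :: "int list \<Rightarrow> real \<times> real \<Rightarrow> real \<times> real" where
  "cf_act [] w = w"
| "cf_act (a # as) w = (a * fst (cf_act as w) + snd (cf_act as w), fst (cf_act as w))"

lemma cf_act_append: "cf_act (as @ bs) w = cf_act as (cf_act bs w)"
  by (induction as) simp_all

lemma cf_eval_append: "cf_eval (as @ bs) z = cf_eval as (cf_eval bs z)"
  by (induction as) simp_all

lemma cf_eval_pos:
  assumes "\<forall>a\<in>set as. a \<ge> 1" "z > 0"
  shows "cf_eval as z > 0"
  using assms by (induction as) (auto intro!: add_pos_nonneg)

text \<open>Positivity of both coordinates is carried through the induction because each step
  inverts their quotient.\<close>

lemma cf_eval_conv_cf_act:
  assumes "\<forall>a\<in>set as. a \<ge> 1" "z > 0"
  shows "fst (cf_act as (z, 1)) > 0 \<and> snd (cf_act as (z, 1)) > 0 \<and>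
    cf_eval as z = fst (cf_act as (z, 1)) / snd (cf_act as (z, 1))"
  using assms
proof (induction as)
  case (Cons a as)
  then have "real_of_int a \<ge> 1" by simp
  with Cons show ?case
    by (auto simp: field_simps intro!: add_pos_pos)
qed simp

text \<open>The complete quotients are the suffixes of \<open>L\<close> evaluated at
  \<open>w\<close>.\<close>

lemma has_simple_cf_periodic:
  fixes w :: real
  assumes pos: "\<forall>a\<in>set L. a \<ge> 1" and "L \<noteq> []" "w > 0" and fix_w: "cf_eval L w = w"
  shows "has_simple_cf (b0 + 1 / w) (periodic_seq b0 L)"
proof -
  define l where "l = length L"
  have l: "l > 0" using \<open>L \<noteq> []\<close> by (simp add: l_def)
  define Y where "Y i = cf_eval (drop (i mod l) L) w" for i
  have step: "Y i = L ! (i mod l) + 1 / Y (Suc i)" for i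
  proof -
    have lt: "i mod l < length L" using l by (simp add: l_def)
    have "Y i = L ! (i mod l) + 1 / cf_eval (drop (Suc (i mod l)) L) w"
      unfolding Y_def by (subst Cons_nth_drop_Suc[OF lt, symmetric]) simp
    \<comment> \<open>At the end of the period the suffix is empty and evaluates to
      \<open>w\<close>, which \<open>fix_w\<close> identifies with the value of the whole of
      \<open>L\<close>.\<close>
    moreover have "cf_eval (drop (Suc (i mod l)) L) w = Y (Suc i)"
      using fix_w by (auto simp: Y_def mod_Suc l_def)
    ultimately show ?thesis by simp
  qed
  have Y_pos: "Y i > 0" for i
    unfolding Y_def using pos \<open>w > 0\<close> by (intro cf_eval_pos) (auto dest: in_set_dropD)
  have L_ge: "L ! (i mod l) \<ge> 1" for i
    using pos l by (simp add: l_def)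
  have Y_ge: "Y i \<ge> 1" for i
  proof -
    have "1 / Y (Suc i) > 0" "real_of_int (L ! (i mod l)) \<ge> 1"
      using Y_pos[of "Suc i"] L_ge[of i] by simp_all
    then show ?thesis using step[of i] by linarith
  qed
  define X where "X i = (case i of 0 \<Rightarrow> b0 + 1 / w | Suc j \<Rightarrow> Y j)" for i
  have Y0: "Y 0 = w"
    using fix_w by (simp add: Y_def)
  have "X i = periodic_seq b0 L i + 1 / X (Suc i)" for i
    using step[of "i - 1"] Y0 by (cases i) (simp_all add: X_def periodic_seq_def l_def)
  moreover have "X i \<ge> 1" "periodic_seq b0 L i \<ge> 1" if "i \<ge> 1" for i
    using that Y_ge L_ge by (cases i; simp add: X_def periodic_seq_def l_def)+
  ultimately have "has_simple_cf (X 0) (periodic_seq b0 L)"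
    by (intro has_simple_cf_complete_quotients)
  then show ?thesis by (simp add: X_def)
qed

text \<open>With \<open>w = 1 / (x - s)\<close> the last term gives
  \<open>2 s + 1 / w = x + s\<close>. So \<open>eq\<close> is the fixed point equation for
  \<open>w\<close> with denominators cleared.\<close>

lemma has_simple_cf_period_ending_in_double:
  fixes x :: real
  assumes pos: "\<forall>a\<in>set P. a \<ge> 1" and "s \<ge> 1" "x > s"
    and eq: "(x - s) * fst (cf_act P (x + s, 1)) = snd (cf_act P (x + s, 1))"
  shows "has_simple_cf x (periodic_seq s (P @ [2 * s]))"
proof -
  define w where "w = 1 / (x - s)"
  have "w > 0" using \<open>x > s\<close> by (simp add: w_def)
  have xs: "x + s > 0" using assms(2,3) by simp
  have "cf_eval P (x + s) = w"
    using cf_eval_conv_cf_act[OF pos xs] eq \<open>x > s\<close>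
    by (simp add: w_def field_simps)
  moreover have "real_of_int (2 * s) + 1 / w = x + s"
    by (simp add: w_def)
  ultimately have "cf_eval (P @ [2 * s]) w = w"
    by (simp only: cf_eval_append cf_eval.simps)
  then have "has_simple_cf (s + 1 / w) (periodic_seq s (P @ [2 * s]))"
    using pos \<open>s \<ge> 1\<close> \<open>w > 0\<close> by (intro has_simple_cf_periodic) auto
  then show ?thesis by (simp add: w_def)
qed

section \<open>Fibonacci polynomials\<close>

abbreviation (input) F :: "nat \<Rightarrow> int \<Rightarrow> int" where "F \<equiv> fib_poly_nat"

lemma fib_poly_int: "fib_poly (int h) m = F h m"
  by (simp add: fib_poly_def)

lemma fib_poly_nat_nonneg: "m \<ge> 0 \<Longrightarrow> F j m \<ge> 0"
  by (induction j m rule: fib_poly_nat.induct) auto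

lemma fib_poly_nat_Suc_pos: "m > 0 \<Longrightarrow> F (Suc j) m > 0"
proof (induction j rule: induct_nat_012)
  case (ge2 j)
  have "m * F (Suc (Suc j)) m \<ge> 0"
    using ge2.prems by (intro mult_nonneg_nonneg fib_poly_nat_nonneg) auto
  with ge2 show ?case
    using fib_poly_nat.simps(3)[of "Suc j" m] by linarith
qed auto

lemma fib_poly_nat_cassini:
  "(F (Suc j) m)\<^sup>2 - F (Suc (Suc j)) m * F j m = (-1) ^ j"
proof (induction j)
  case (Suc j)
  have "(F (Suc (Suc j)) m)\<^sup>2 - F (Suc (Suc (Suc j))) m * F (Suc j) m =
      - ((F (Suc j) m)\<^sup>2 - F (Suc (Suc j)) m * F j m)"
    by (simp add: power2_eq_square algebra_simps)
  with Suc show ?case by simp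
qed simp

text \<open>Modulo 2 the recurrence preserves the value when the index grows by 2. This later gives
  \<open>s\<close> the parity of \<open>k\<close>.\<close>

lemma even_fib_poly_nat_double:
  assumes "even m"
  shows "even (F (2 * h) m) \<and> odd (F (Suc (2 * h)) m)"
  using assms by (induction h) auto

text \<open>Here \<open>a\<close>, \<open>b\<close>, \<open>d\<close>, \<open>e\<close> are four
  consecutive values, from index \<open>n + 1\<close> down to \<open>n - 2\<close>. Both
  \<open>s\<close> and \<open>-t\<close> increase with \<open>k\<close>, so the inequalities are
  checked at \<open>k = 1 - e\<close>.\<close>

lemma parameter_bounds:
  fixes a b d e k m s t :: int
  assumes a: "a = m * b + d" and b: "b = m * d + e" and cassini: "d\<^sup>2 - b * e = 1"
    and pos: "m > 0" "a > 0" "b > 0" and k: "k \<ge> 1 - e"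
    and s: "s = b * d + k * a" and t: "t = - d\<^sup>2 - k * b"
  shows "a * (- t) = b * s + d" and "s \<ge> a + m" and "t < 0"
proof -
  have "a * d = b\<^sup>2 + 1"
    using cassini unfolding a b by (simp add: algebra_simps power2_eq_square)
  moreover have "a * (- t) = (a * d) * d + k * (a * b)" "b * s + d = (b\<^sup>2 + 1) * d + k * (a * b)"
    unfolding s t by (simp_all add: algebra_simps power2_eq_square)
  ultimately show "a * (- t) = b * s + d"
    by simp
  \<comment> \<open>The left side is \<open>s\<close> at the least \<open>k\<close>; Cassini turns
    the right side into \<open>a + m\<close>. Likewise \<open>-t\<close> is at least
    \<open>b + 1\<close>.\<close>
  have "b * d + (1 - e) * a = a + m * (d\<^sup>2 - b * e)"
    unfolding a by (subst (1) b) (simp add: algebra_simps power2_eq_square)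
  moreover have "(1 - e) * a \<le> k * a" "(1 - e) * b \<le> k * b"
    using k pos by (simp_all add: mult_right_mono)
  ultimately show "s \<ge> a + m" "t < 0"
    using s t cassini pos by (simp_all add: algebra_simps)
qed

section \<open>Moebius transformations of the blocks\<close>

text \<open>The pair \<open>m/2, 2m\<close> has matrix \<open>(m^2 + 1, m/2; 2m, 1)\<close>, a
  diagonal conjugate of the square of \<open>(m, 1; 1, 0)\<close>. Hence the even indices
  below.\<close>

lemma v_seq_Suc_Suc: "v_seq (2 * Suc h) m = v_seq (2 * h) m @ [m div 2, 2 * m]"
  by (simp add: v_seq_def)

text \<open>In the next lemmas \<open>f\<^sub>n\<^sub>-\<^sub>1\<close> appears as \<open>f\<^sub>n\<^sub>+\<^sub>1 - m f\<^sub>n\<close>, which makes sense for \<open>n = 0\<close>.\<close>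

lemma cf_act_v_seq:
  fixes X Y :: real
  assumes "m = 2 * r"
  shows "cf_act (v_seq (2 * h) m) (X, Y) =
    (F (Suc (2 * h)) m * X + F (2 * h) m / 2 * Y,
     2 * F (2 * h) m * X + (F (Suc (2 * h)) m - m * F (2 * h) m) * Y)"
proof (induction h arbitrary: X Y)
  case 0
  then show ?case by (simp add: v_seq_def)
next
  case (Suc h)
  show ?case
    unfolding v_seq_Suc_Suc cf_act_append cf_act.simps fst_conv snd_conv Suc.IH
    by (simp add: assms algebra_simps add_divide_distrib)
qed

lemma cf_act_rev_v_seq:
  fixes X Y :: real
  assumes "m = 2 * r"
  shows "cf_act (rev (v_seq (2 * h) m)) (X, Y) =
    (F (Suc (2 * h)) m * X + 2 * F (2 * h) m * Y,
     F (2 * h) m / 2 * X + (F (Suc (2 * h)) m - m * F (2 * h) m) * Y)"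
proof (induction h arbitrary: X Y)
  case 0
  then show ?case by (simp add: v_seq_def)
next
  case (Suc h)
  show ?case
    unfolding v_seq_Suc_Suc rev_append cf_act_append Suc.IH
    by (simp add: assms algebra_simps add_divide_distrib)
qed

text \<open>The block \<open>1, 1, r - 1\<close> has matrix \<open>M = (2r - 1, 2; r, 1)\<close> of
  trace \<open>m\<close> and determinant -1. By Cayley-Hamilton its powers obey the Fibonacci
  recurrence, so the n-th power is \<open>f_n M + f_(n-1) I\<close>.\<close>

lemma cf_act_u_seq:
  fixes X Y :: real
  assumes m: "m = 2 * r"
  shows "cf_act (u_seq n m) (X, Y) =
    ((F (Suc n) m - F n m) * X + 2 * F n m * Y,
     r * F n m * X + (F (Suc n) m - m * F n m + F n m) * Y)"
proof (induction n)
  case 0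
  then show ?case by (simp add: u_seq_def)
next
  case (Suc n)
  have "u_seq (Suc n) m = [1, 1, r - 1] @ u_seq n m"
    using m by (simp add: u_seq_def)
  then show ?case
    by (simp add: Suc.IH) (simp add: m algebra_simps)
qed

lemma cf_act_replicate:
  fixes X Y :: real
  shows "cf_act (replicate n m) (X, Y) =
    (F (Suc n) m * X + F n m * Y, F n m * X + (F (Suc n) m - m * F n m) * Y)"
  by (induction n) (simp_all add: algebra_simps)

lemma cf_act_u_seq_1_1:
  fixes X Y A B :: real
  assumes "m = 2 * r" "F (Suc n) m = A" "F n m = 2 * B"
  shows "cf_act (u_seq n m @ [1, 1]) (X, Y) =
    (2 * A * X + (A + 2 * B) * Y, (A + 2 * B) * X + (A - m * B + 2 * B) * Y)"
  by (simp add: cf_act_append cf_act_u_seq[OF assms(1)] assms(2,3) del: fib_poly_nat.simps)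
    (simp add: assms(1) algebra_simps)

text \<open>At \<open>m = 2\<close> the term \<open>(m - 2)/2\<close> is 0, and a zero merges its
  neighbours: \<open>1, 0, 1\<close> becomes 2. The block \<open>u, 1, 1\<close> collapses to this
  one, so the matrix is the same.\<close>

lemma cf_act_1_replicate_2_1:
  fixes X Y A B :: real
  assumes "m = 2" "F (Suc n) m = A" "F n m = 2 * B"
  shows "cf_act ([1] @ replicate n m @ [1]) (X, Y) =
    (2 * A * X + (A + 2 * B) * Y, (A + 2 * B) * X + (A - m * B + 2 * B) * Y)"
  by (simp add: cf_act_append cf_act_replicate assms(2,3) del: fib_poly_nat.simps)
    (simp add: assms(1) algebra_simps)

lemma v_seq_ge_1:
  assumes "m > 0" "even m"
  shows "\<forall>a\<in>set (v_seq n m). a \<ge> 1"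
  using assms by (auto simp: v_seq_def)

lemma u_seq_ge_1:
  assumes "m > 2" "even m"
  shows "\<forall>a\<in>set (u_seq n m). a \<ge> 1"
  using assms by (auto simp: u_seq_def)

section \<open>The expansions\<close>

text \<open>
  If \<open>x\<^sup>2 = s\<^sup>2 + 4T\<close>, then \<open>x + s\<close> is fixed by the symmetric matrix \<open>(p, q; q, q')\<close> preceded by \<open>2s\<close>
  as soon as \<open>4Tp = 2sq + q'\<close>.
\<close>

lemma symmetric_moebius_identity:
  fixes x s T p q q' :: real
  assumes "x\<^sup>2 = s\<^sup>2 + 4 * T" "4 * T * p = 2 * s * q + q'"
  shows "(x - s) * (p * (x + s) + q) = q * (x + s) + q'"
proof -
  have "(x - s) * (p * (x + s) + q) = p * (x\<^sup>2 - s\<^sup>2) + q * (x - s)"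
    by (simp add: algebra_simps power2_eq_square)
  also have "\<dots> = q * (x + s) + q'"
    using assms by (simp add: algebra_simps)
  finally show ?thesis .
qed

text \<open>In the next two identities \<open>b\<close> stands for \<open>f\<^sub>n/2\<close>, and so does \<open>B\<close> later on; this avoids divisions.\<close>

lemma even_case_identity:
  fixes a b d r x T :: real
  assumes aT: "a * T = 2 * b * (2 * r) + d" and x: "x\<^sup>2 = (2 * r)\<^sup>2 + 4 * T"
    and R: "R = a * (x + 2 * r) + 4 * b" and S: "S = b * (x + 2 * r) + d"
    and R': "R' = r * R + S"
  shows "(x - 2 * r) * (a * R' + b * R) = 4 * b * R' + d * R"
proof -
  \<comment> \<open>These are the entries of \<open>V C V^T\<close> with
    \<open>V = (a, b; 4b, d)\<close> and \<open>C = (r, 1; 1, 0)\<close>. The factor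
    \<open>a\<close> in \<open>p\<close> lets \<open>aT\<close> be applied without division.\<close>
  define p q q' where "p = a * (a * r + 2 * b)" and "q = 4 * a * b * r + 4 * b\<^sup>2 + a * d"
    and "q' = 16 * b\<^sup>2 * r + 8 * b * d"
  have "4 * T * p = 4 * (a * T) * (a * r + 2 * b)"
    by (simp add: p_def)
  also have "\<dots> = 2 * (2 * r) * q + q'"
    unfolding aT q_def q'_def by (simp add: algebra_simps power2_eq_square)
  finally have "4 * T * p = 2 * (2 * r) * q + q'" .
  note symmetric_moebius_identity[OF x this]
  moreover have "a * R' + b * R = p * (x + 2 * r) + q"
    unfolding R' R S p_def q_def by (simp add: algebra_simps power2_eq_square)
  moreover have "4 * b * R' + d * R = q * (x + 2 * r) + q'"
    unfolding R' R S q_def q'_def by (simp add: algebra_simps power2_eq_square)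
  ultimately show ?thesis by simp
qed

lemma odd_case_identity:
  fixes a b d s w u x T :: real
  assumes aT: "a * T = 2 * b * s + d" and x: "x\<^sup>2 = s\<^sup>2 + 4 * T"
    and w: "2 * w = s\<^sup>2 * a + 4 * s * b + d" and u: "u = s * a + 2 * b"
    and R: "R = a * (x + s) + 4 * b" and S: "S = b * (x + s) + d"
    and R': "R' = w * R + u * S" and S': "S' = u * R + 2 * a * S"
  shows "(x - s) * (a * R' + b * S') = 4 * b * R' + d * S'"
proof -
  \<comment> \<open>Again the entries of \<open>V C V^T\<close>, now with
    \<open>C = (w, u; u, 2a)\<close>.\<close>
  define p q q' where "p = a * (a * w + 2 * b * u + 2 * b\<^sup>2)"
    and "q = 4 * a * b * w + (4 * b\<^sup>2 + a * d) * u + 2 * a * b * d"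
    and "q' = 16 * b\<^sup>2 * w + 8 * b * d * u + 2 * a * d\<^sup>2"
  have "4 * T * p = 2 * (a * T) * (a * (2 * w) + 4 * b * u + 4 * b\<^sup>2)"
    by (simp add: p_def algebra_simps)
  also have "\<dots> = 2 * s * (2 * a * b * (2 * w) + (4 * b\<^sup>2 + a * d) * u + 2 * a * b * d)
      + 8 * b\<^sup>2 * (2 * w) + 8 * b * d * u + 2 * a * d\<^sup>2"
    unfolding aT w u by (simp add: algebra_simps power2_eq_square)
  also have "\<dots> = 2 * s * q + q'"
    by (simp add: q_def q'_def algebra_simps)
  finally have "4 * T * p = 2 * s * q + q'" .
  note symmetric_moebius_identity[OF x this]
  moreover have "a * R' + b * S' = p * (x + s) + q"
    unfolding R' S' R S p_def q_def by (simp add: algebra_simps power2_eq_square)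
  moreover have "4 * b * R' + d * S' = q * (x + s) + q'"
    unfolding R' S' R S q_def q'_def by (simp add: algebra_simps power2_eq_square)
  ultimately show ?thesis by simp
qed

text \<open>Collects all that the expansions need, in real form: \<open>A = f_(n+1)\<close>,
  \<open>B = f_n / 2\<close>, \<open>D = f_(n-1)\<close>, \<open>T = -t\<close>.\<close>

lemma expansion_data:
  fixes m k s t :: int and n :: nat and \<beta> :: real
  assumes "m > 0" and "even m" and "n > 0" and "even n"
    and "k \<ge> (-1) ^ (n - 1) * fib_poly (int n - 2) m + 1"
    and "s = (-1) ^ n * fib_poly (int n) m * fib_poly (int n - 1) m + k * fib_poly (int n + 1) m"
    and "t = (-1) ^ (n - 1) * (fib_poly (int n - 1) m)\<^sup>2 - k * fib_poly (int n) m"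
    and "\<beta> = sqrt (real_of_int (s\<^sup>2 - 4 * t))"
  obtains A B D T :: real where
    "A * T = 2 * B * s + D" and "\<beta>\<^sup>2 = (real_of_int s)\<^sup>2 + 4 * T" and "\<beta> > s"
    and "s \<ge> 3" and "even s \<longleftrightarrow> even k"
    and "\<And>X Y. cf_act (v_seq n m) (X, Y) = (A * X + B * Y, 4 * B * X + D * Y)"
    and "\<And>X Y. cf_act (rev (v_seq n m)) (X, Y) = (A * X + 4 * B * Y, B * X + D * Y)"
    and "2 * (A - m * B) = A + D" and "F (Suc n) m = A" and "F n m = 2 * B"
proof -
  from \<open>even n\<close> obtain h where n: "n = 2 * h" by (elim evenE)
  with \<open>n > 0\<close> obtain j where j: "n = Suc (Suc j)" "even j"
    by (cases h) auto
  define a b d e where "a = F (Suc n) m" and "b = F n m" and "d = F (Suc j) m" and "e = F j m"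
  have a_rec: "a = m * b + d" and b_rec: "b = m * d + e"
    by (simp_all add: a_def b_def d_def e_def j)
  have idx: "int n - 1 = int (Suc j)" "int n - 2 = int j" "int n + 1 = int (Suc n)"
    unfolding j(1) by simp_all
  have sgn: "(-1 :: int) ^ n = 1" "(-1 :: int) ^ (n - 1) = -1"
    using j by simp_all
  have k: "k \<ge> 1 - e"
    using assms(5) unfolding idx sgn fib_poly_int e_def by linarith
  have s: "s = b * d + k * a"
    using assms(6) unfolding idx sgn fib_poly_int a_def b_def d_def by linarith
  have t: "t = - d\<^sup>2 - k * b"
    using assms(7) unfolding idx sgn fib_poly_int b_def d_def by linarith
  have cassini: "d\<^sup>2 - b * e = 1"
    using fib_poly_nat_cassini[of j m] j by (simp add: b_def d_def e_def)
  have a_pos: "a > 0" and b_pos: "b > 0"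
    unfolding a_def b_def j(1) by (rule fib_poly_nat_Suc_pos[OF \<open>m > 0\<close>])+
  note bounds = parameter_bounds[OF a_rec b_rec cassini \<open>m > 0\<close> a_pos b_pos k s t]
  have parity: "even b" "odd a"
    using even_fib_poly_nat_double[OF \<open>even m\<close>, of h] by (simp_all add: a_def b_def n)
  have "m \<ge> 2"
    using \<open>m > 0\<close> \<open>even m\<close> by presburger
  then have s_ge: "s \<ge> 3"
    using bounds(2) a_pos by linarith
  have s_parity: "even s \<longleftrightarrow> even k"
    using parity by (simp add: s)

  obtain r where r: "m = 2 * r"
    using \<open>even m\<close> by (elim evenE)
  define A B D T where "A = real_of_int a" and "B = real_of_int b / 2" and "D = real_of_int d"
    and "T = - real_of_int t"
  have AT: "A * T = 2 * B * s + D"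
    using arg_cong[OF bounds(1), of real_of_int] by (simp add: A_def B_def D_def T_def)
  have T_pos: "T > 0"
    using bounds(3) by (simp add: T_def)
  have \<beta>: "\<beta> = sqrt ((real_of_int s)\<^sup>2 + 4 * T)"
    unfolding assms(8) by (simp add: T_def)
  then have \<beta>2: "\<beta>\<^sup>2 = (real_of_int s)\<^sup>2 + 4 * T"
    using T_pos by simp
  have "\<beta> > s"
    unfolding \<beta> using T_pos by (intro real_less_rsqrt) simp

  have D: "F (Suc (2 * h)) m - m * F (2 * h) m = d"
    using a_rec by (simp add: a_def b_def n)
  have act_v: "cf_act (v_seq n m) (X, Y) = (A * X + B * Y, 4 * B * X + D * Y)" for X Y
    using cf_act_v_seq[OF r, of h X Y, unfolded D, folded n, folded a_def b_def]
    by (simp add: A_def B_def D_def)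
  have act_rev: "cf_act (rev (v_seq n m)) (X, Y) = (A * X + 4 * B * Y, B * X + D * Y)" for X Y
    using cf_act_rev_v_seq[OF r, of h X Y, unfolded D, folded n, folded a_def b_def]
    by (simp add: A_def B_def D_def)
  have E: "2 * (A - m * B) = A + D" and AB: "F (Suc n) m = A" "F n m = 2 * B"
    using a_rec by (simp_all add: A_def B_def D_def a_def b_def)
  show ?thesis
    by (rule that[OF AT \<beta>2 \<open>\<beta> > s\<close> s_ge s_parity act_v act_rev E AB])
qed

lemma has_simple_cf_even_middle:
  fixes x A B D T :: real
  assumes AT: "A * T = 2 * B * s + D" and x: "x\<^sup>2 = (real_of_int s)\<^sup>2 + 4 * T" "x > s"
    and s: "s \<ge> 3" "even s"
    and v_ge: "\<forall>a\<in>set v. a \<ge> 1"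
    and act_v: "\<And>X Y. cf_act v (X, Y) = (A * X + B * Y, 4 * B * X + D * Y)"
    and act_rev: "\<And>X Y. cf_act (rev v) (X, Y) = (A * X + 4 * B * Y, B * X + D * Y)"
  shows "has_simple_cf x (periodic_seq s ((v @ [s div 2] @ rev v) @ [2 * s]))"
proof (rule has_simple_cf_period_ending_in_double)
  obtain r where r: "s = 2 * r"
    using \<open>even s\<close> by (elim evenE)
  then have s_r: "real_of_int s = 2 * real_of_int r" and c: "s div 2 = r"
    by simp_all
  show "(x - s) * fst (cf_act (v @ [s div 2] @ rev v) (x + s, 1)) =
      snd (cf_act (v @ [s div 2] @ rev v) (x + s, 1))"
    unfolding c
    using even_case_identity[OF AT[unfolded s_r] x(1)[unfolded s_r] refl refl refl]
    by (simp only: s_r cf_act_append cf_act.simps act_v act_rev fst_conv snd_conv mult_1_right)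
  show "\<forall>a\<in>set (v @ [s div 2] @ rev v). 1 \<le> a"
    using v_ge s(1) r by (simp add: ball_Un)
  show "s \<ge> 1" "x > s"
    using s(1) x(2) by simp_all
qed

text \<open>The inner block \<open>u\<close> enters only through its matrix, so one argument serves
  \<open>m > 2\<close> and \<open>m = 2\<close>.\<close>

lemma has_simple_cf_odd_middle:
  fixes x A B D E T :: real
  assumes AT: "A * T = 2 * B * s + D" and x: "x\<^sup>2 = (real_of_int s)\<^sup>2 + 4 * T" "x > s"
    and s: "s \<ge> 3" "odd s"
    and v_ge: "\<forall>a\<in>set v. a \<ge> 1"
    and act_v: "\<And>X Y. cf_act v (X, Y) = (A * X + B * Y, 4 * B * X + D * Y)"
    and act_rev: "\<And>X Y. cf_act (rev v) (X, Y) = (A * X + 4 * B * Y, B * X + D * Y)"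
    and u_ge: "\<forall>a\<in>set u. a \<ge> 1"
    and act_u: "\<And>X Y. cf_act u (X, Y) =
      (2 * A * X + (A + 2 * B) * Y, (A + 2 * B) * X + (E + 2 * B) * Y)"
    and E: "2 * E = A + D"
  shows "has_simple_cf x
    (periodic_seq s ((v @ [(s - 1) div 2] @ u @ [(s - 1) div 2] @ rev v) @ [2 * s]))"
proof (rule has_simple_cf_period_ending_in_double)
  obtain r where r: "s = 2 * r + 1"
    using \<open>odd s\<close> by (elim oddE)
  then have s_r: "real_of_int s = 2 * real_of_int r + 1" and c: "(s - 1) div 2 = r"
    by simp_all
  let ?P = "v @ [r] @ u @ [r] @ rev v"
  \<comment> \<open>The block \<open>r, u, r\<close> has symmetric matrix
    \<open>(w, y; y, 2A)\<close>. Substituting \<open>r = (s - 1)/2\<close> cancels the terms that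
    keep \<open>w\<close> and \<open>y\<close> from being simple in \<open>s\<close>.\<close>
  define w where "w = 2 * A * (real_of_int r)\<^sup>2 + 2 * (A + 2 * B) * real_of_int r + (E + 2 * B)"
  have w: "2 * w = (real_of_int s)\<^sup>2 * A + 4 * real_of_int s * B + D"
    using E by (simp add: w_def s_r power2_eq_square algebra_simps)
  define y where "y = real_of_int s * A + 2 * B"
  have act: "cf_act [r] (cf_act u (cf_act [r] (X, Y))) = (w * X + y * Y, y * X + 2 * A * Y)" for X Y :: real
    by (simp add: act_u w_def y_def s_r algebra_simps power2_eq_square)
  have "(x - s) * fst (cf_act ?P (x + s, 1)) = snd (cf_act ?P (x + s, 1))"
    using odd_case_identity[OF AT x(1) w y_def refl refl refl refl]
    by (simp only: cf_act_append act act_v act_rev fst_conv snd_conv mult_1_right)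
  then show "(x - s) * fst (cf_act (v @ [(s - 1) div 2] @ u @ [(s - 1) div 2] @ rev v) (x + s, 1)) =
      snd (cf_act (v @ [(s - 1) div 2] @ u @ [(s - 1) div 2] @ rev v) (x + s, 1))"
    by (simp only: c)
  \<comment> \<open>Since \<open>s >= 3\<close>, the middle terms \<open>(s - 1)/2\<close> are at
    least 1.\<close>
  show "\<forall>a\<in>set (v @ [(s - 1) div 2] @ u @ [(s - 1) div 2] @ rev v). 1 \<le> a"
    using v_ge u_ge s(1) r by (simp add: ball_Un)
  show "s \<ge> 1" "x > s"
    using s(1) x(2) by simp_all
qed

theorem theorem3p5:
  fixes m k s t :: int and n :: nat and \<beta> :: real
  assumes "m > 0" and "even m" and "n > 0" and "even n"
    and "k \<ge> (-1) ^ (n - 1) * fib_poly (int n - 2) m + 1"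
    and "s = (-1) ^ n * fib_poly (int n) m * fib_poly (int n - 1) m + k * fib_poly (int n + 1) m"
    and "t = (-1) ^ (n - 1) * (fib_poly (int n - 1) m)\<^sup>2 - k * fib_poly (int n) m"
    and "\<beta> = sqrt (real_of_int (s\<^sup>2 - 4 * t))"
  shows
    "(even k \<longrightarrow>
        has_simple_cf \<beta> (periodic_seq s (v_seq n m @ [s div 2] @ rev (v_seq n m) @ [2 * s]))) \<and>
     (odd k \<and> m > 2 \<longrightarrow>
        has_simple_cf \<beta> (periodic_seq s
          (v_seq n m @ [(s - 1) div 2] @ u_seq n m @ [1, 1, (s - 1) div 2]
           @ rev (v_seq n m) @ [2 * s]))) \<and>
     (odd k \<and> m = 2 \<longrightarrow>
        has_simple_cf \<beta> (periodic_seq s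
          (v_seq n 2 @ [(s - 1) div 2, 1] @ replicate n 2 @ [1, (s - 1) div 2]
           @ rev (v_seq n 2) @ [2 * s])))"
proof -
  obtain A B D T :: real where AT: "A * T = 2 * B * real_of_int s + D"
    and \<beta>: "\<beta>\<^sup>2 = (real_of_int s)\<^sup>2 + 4 * T" "\<beta> > real_of_int s"
    and s: "s \<ge> 3" "even s \<longleftrightarrow> even k"
    and act_v: "\<And>X Y :: real. cf_act (v_seq n m) (X, Y) = (A * X + B * Y, 4 * B * X + D * Y)"
    and act_rev: "\<And>X Y :: real. cf_act (rev (v_seq n m)) (X, Y) = (A * X + 4 * B * Y, B * X + D * Y)"
    and E: "2 * (A - real_of_int m * B) = A + D"
    and AB: "real_of_int (F (Suc n) m) = A" "real_of_int (F n m) = 2 * B"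
    by (rule expansion_data[OF assms], rule that)
  obtain r where r: "m = 2 * r"
    using \<open>even m\<close> by (elim evenE)
  note v_ge = v_seq_ge_1[OF \<open>m > 0\<close> \<open>even m\<close>, of n]
  have "has_simple_cf \<beta> (periodic_seq s
      ((v_seq n m @ [s div 2] @ rev (v_seq n m)) @ [2 * s]))" if "even k"
    using that s(2)
    by (intro has_simple_cf_even_middle[OF AT \<beta> s(1) _ v_ge act_v act_rev]) simp
  moreover have "has_simple_cf \<beta> (periodic_seq s
      ((v_seq n m @ [(s - 1) div 2] @ (u_seq n m @ [1, 1]) @ [(s - 1) div 2] @ rev (v_seq n m)) @ [2 * s]))"
    if "odd k" "m > 2"
    using that s(2) u_seq_ge_1[OF \<open>m > 2\<close> \<open>even m\<close>, of n]
    by (intro has_simple_cf_odd_middle[OF AT \<beta> s(1) _ v_ge act_v act_rev _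
          cf_act_u_seq_1_1[OF r AB] E]) (simp_all add: ball_Un)
  \<comment> \<open>The twos are written as \<open>m\<close> so that the facts about
    \<open>v_seq n m\<close> apply; \<open>m = 2\<close> is substituted at the end.\<close>
  moreover have "has_simple_cf \<beta> (periodic_seq s
      ((v_seq n m @ [(s - 1) div 2] @ ([1] @ replicate n m @ [1]) @ [(s - 1) div 2] @ rev (v_seq n m)) @ [2 * s]))"
    if "odd k" "m = 2"
    using that s(2)
    by (intro has_simple_cf_odd_middle[OF AT \<beta> s(1) _ v_ge act_v act_rev _
          cf_act_1_replicate_2_1[OF \<open>m = 2\<close> AB] E]) simp_all
  ultimately show ?thesis by auto
qed

end
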